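(* Let $a\ge1$ and $n\ge a+2$, and let $K(1^a21^{n-a-2})$ be the generalized bull, i.e. the graph obtained from the path $v_1v_2\cdots v_n$ by adding the edge $v_av_{a+2}$. Then \[ X_{K(1^a21^{n-a-2})}=\sum_{\substack{I\vDash n,\ i_{-1}\ge3\\ \Theta_I^+(a)\le1}}\frac{i_{-1}-2}{i_{-1}-1}\,w_Ie_I+\sum_{\substack{I\vDash n\\ \Theta_I^+(a)\ge2}}2\,w_Ie_I+\sum_{\substack{J\vDash n-1\\ \Theta_J^+(a)\ge2}}w_J\,e_{J1}. \]
   Context: A composition $I=i_1\cdots i_s\vDash n$ is a sequence of positive integers with sum $n$; $i_{-1}=i_s$; $J1$ denotes the composition $J$ followed by a part $1$; $e_I=e_{i_1}\cdots e_{i_s}$ (elementary symmetric functions); $w_I=i_1\prod_{j\ge2}(i_j-1)$. For $0\le c\le|I|$, $\sigma_I^+(c)=\min\{i_1+\dots+i_k:0\le k\le s,\ i_1+\dots+i_k\ge c\}$ and $\Theta_I^+(c)=\sigma_I^+(c)-c$. The chromatic symmetric function is $X_G=\sum_\kappa\prod_vx_{\kappa(v)}$ over proper colorings $\kappa:V(G)\to\{1,2,\dots\}$. *)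

theory Defs
  imports Complex_Main "HOL-Library.Multiset" "HOL-Library.FuncSet"
begin

section \<open>Formal power series in the variables \<open>x\<^sub>0, x\<^sub>1, x\<^sub>2, \<dots>\<close>\<close>

text \<open>
  A monomial is encoded as the finite multiset of the indices of its variables, so that
  \<open>{#1, 1, 3#}\<close> is the monomial \<open>x\<^sub>1\<^sup>2 x\<^sub>3\<close>, and multiplication of monomials
  is multiset union. Symmetric functions live in this ring of power series;
  the variable \<open>x\<^sub>0\<close> is not used by them.
\<close>

typedef 'a mps = "UNIV :: (nat multiset \<Rightarrow> 'a) set"
  morphisms mps_coeff Abs_mps ..

setup_lifting type_definition_mps

lemma mps_eqI: "(\<And>m. mps_coeff f m = mps_coeff g m) \<Longrightarrow> f = g"
  by transfer auto

lemma finite_submultisets: "finite {a. a \<subseteq># (m :: 'b multiset)}"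
proof (induction m)
  case empty
  then show ?case by simp
next
  case (add x m)
  have "{a. a \<subseteq># add_mset x m} \<subseteq> {a. a \<subseteq># m} \<union> add_mset x ` {a. a \<subseteq># m}"
  proof
    fix a assume "a \<in> {a. a \<subseteq># add_mset x m}"
    then have a: "a \<subseteq># add_mset x m" by simp
    show "a \<in> {a. a \<subseteq># m} \<union> add_mset x ` {a. a \<subseteq># m}"
    proof (cases "x \<in># a")
      case True
      then obtain b where b: "a = add_mset x b" by (metis multi_member_split)
      with a show ?thesis by auto
    next
      case False
      with a have "a \<subseteq># m"
        by (metis diff_single_trivial subset_eq_diff_conv add_mset_add_single)
      then show ?thesis by simp
    qed
  qed
  then show ?case using add by (meson finite_UnI finite_imageI finite_subset)
qed

instantiation mps :: (comm_ring_1) comm_ring_1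
begin

lift_definition zero_mps :: "'a mps" is "\<lambda>_. 0" .
lift_definition one_mps :: "'a mps" is "\<lambda>m. if m = {#} then 1 else 0" .
lift_definition plus_mps :: "'a mps \<Rightarrow> 'a mps \<Rightarrow> 'a mps" is "\<lambda>f g m. f m + g m" .
lift_definition minus_mps :: "'a mps \<Rightarrow> 'a mps \<Rightarrow> 'a mps" is "\<lambda>f g m. f m - g m" .
lift_definition uminus_mps :: "'a mps \<Rightarrow> 'a mps" is "\<lambda>f m. - f m" .
lift_definition times_mps :: "'a mps \<Rightarrow> 'a mps \<Rightarrow> 'a mps"
  is "\<lambda>f g m. \<Sum>a | a \<subseteq># m. f a * g (m - a)" .

instance
proof
  fix f g h :: "'a mps"
  show "f + g + h = f + (g + h)" "f + g = g + f" "0 + f = f" "- f + f = 0" "f - g = f + - g"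
    by (transfer; simp add: algebra_simps)+
  show "f * g * h = f * (g * h)"
  proof (transfer, rule ext)
    fix f g h :: "nat multiset \<Rightarrow> 'a" and m :: "nat multiset"
    have "(\<Sum>a | a \<subseteq># m. (\<Sum>b | b \<subseteq># a. f b * g (a - b)) * h (m - a)) =
        (\<Sum>(a, b) \<in> (SIGMA a:{a. a \<subseteq># m}. {b. b \<subseteq># a}). f b * g (a - b) * h (m - a))"
      by (simp add: sum_distrib_right sum.Sigma finite_submultisets)
    also have "\<dots> = (\<Sum>(a, b) \<in> (SIGMA a:{a. a \<subseteq># m}. {b. b \<subseteq># m - a}).
        f a * (g b * h (m - a - b)))"
      by (rule sum.reindex_bij_witness[where i = "\<lambda>(a, b). (a + b, a)" and j = "\<lambda>(a, b). (b, a - b)"])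
         (auto simp: mult.assoc subset_eq_diff_conv subset_mset.le_diff_conv2 add.commute
           intro: subset_mset.order_trans)
    also have "\<dots> = (\<Sum>a | a \<subseteq># m. f a * (\<Sum>b | b \<subseteq># m - a. g b * h (m - a - b)))"
      by (simp add: sum_distrib_left sum.Sigma finite_submultisets)
    finally show "(\<Sum>a | a \<subseteq># m. (\<Sum>b | b \<subseteq># a. f b * g (a - b)) * h (m - a)) =
        (\<Sum>a | a \<subseteq># m. f a * (\<Sum>b | b \<subseteq># m - a. g b * h (m - a - b)))" .
  qed
  show "f * g = g * f"
  proof (transfer, rule ext)
    fix f g :: "nat multiset \<Rightarrow> 'a" and m :: "nat multiset"
    have mm: "m - (m - a) = a" if "a \<subseteq># m" for a
      using that by (auto simp: multiset_eq_iff subseteq_mset_def)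
    show "(\<Sum>a | a \<subseteq># m. f a * g (m - a)) = (\<Sum>a | a \<subseteq># m. g a * f (m - a))"
      by (rule sum.reindex_bij_witness[where i = "\<lambda>a. m - a" and j = "\<lambda>a. m - a"])
         (simp_all add: mm mult.commute)
  qed
  show "1 * f = f"
  proof (transfer, rule ext)
    fix f :: "nat multiset \<Rightarrow> 'a" and m :: "nat multiset"
    have "(\<Sum>a | a \<subseteq># m. (if a = {#} then 1 else 0) * f (m - a)) =
        (\<Sum>a | a \<subseteq># m. if a = {#} then f m else 0)"
      by (intro sum.cong) auto
    then show "(\<Sum>a | a \<subseteq># m. (if a = {#} then 1 else 0) * f (m - a)) = f m"
      by (simp add: sum.delta finite_submultisets)
  qed
  show "(f + g) * h = f * h + g * h"
    by transfer (simp add: algebra_simps sum.distrib)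
  show "(0 :: 'a mps) \<noteq> 1"
    by transfer (auto simp: fun_eq_iff)
qed

end

lift_definition mps_scale :: "'a :: comm_ring_1 \<Rightarrow> 'a mps \<Rightarrow> 'a mps" (infixr "*\<^sub>\<Lambda>" 75)
  is "\<lambda>c f m. c * f m" .

lift_definition mps_var :: "nat \<Rightarrow> 'a :: comm_ring_1 mps"
  is "\<lambda>i m. if m = {#i#} then 1 else 0" .

text \<open>
  The coefficientwise sum of a possibly infinite family. It is meaningful when each monomial occurs
  in only finitely many members of the family, as is the case for both uses below
  (\<open>coeff_elem_sym\<close> and \<open>coeff_chromatic_sym\<close>).
\<close>

lift_definition mps_infsum :: "('b \<Rightarrow> 'a :: comm_ring_1 mps) \<Rightarrow> 'b set \<Rightarrow> 'a mps"
  is "\<lambda>F S m. \<Sum>k | k \<in> S \<and> F k m \<noteq> 0. F k m" .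

lemma coeff_scale [simp]: "mps_coeff (c *\<^sub>\<Lambda> f) m = c * mps_coeff f m"
  by transfer simp

lemma coeff_prod_var:
  assumes "finite A"
  shows "mps_coeff (\<Prod>v\<in>A. mps_var (k v) :: 'a :: comm_ring_1 mps) m =
    (if m = image_mset k (mset_set A) then 1 else 0)"
  using assms
proof (induction A arbitrary: m)
  case empty
  show ?case by (simp add: one_mps.rep_eq)
next
  case (insert v A)
  have "mps_coeff (\<Prod>v\<in>insert v A. mps_var (k v) :: 'a mps) m =
      (\<Sum>a | a \<subseteq># m. if a = {#k v#} then (if m - a = image_mset k (mset_set A) then 1 else 0) else 0)"
    using insert by (auto simp: times_mps.rep_eq mps_var.rep_eq intro!: sum.cong)
  also have "\<dots> = (if k v \<in># m \<and> m - {#k v#} = image_mset k (mset_set A) then 1 else 0)"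
    by (simp add: sum.delta finite_submultisets)
  also have "(k v \<in># m \<and> m - {#k v#} = image_mset k (mset_set A)) \<longleftrightarrow>
      m = image_mset k (mset_set (insert v A))"
    using insert.hyps by (auto dest!: insert_DiffM)
  finally show ?case .
qed


section \<open>Elementary and chromatic symmetric functions\<close>

definition elem_sym :: "nat \<Rightarrow> 'a :: comm_ring_1 mps" where
  "elem_sym k = mps_infsum (\<lambda>A. \<Prod>i\<in>A. mps_var i) {A. A \<subseteq> {1..} \<and> finite A \<and> card A = k}"

definition elem_sym_comp :: "nat list \<Rightarrow> 'a :: comm_ring_1 mps" where
  "elem_sym_comp I = (\<Prod>i\<leftarrow>I. elem_sym i)"

text \<open>A graph is given by its vertex set and its set of edges, an edge being a set of two vertices.\<close>

definition proper_colorings :: "'v set \<Rightarrow> 'v set set \<Rightarrow> ('v \<Rightarrow> nat) set" where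
  "proper_colorings V E =
    {\<kappa> \<in> V \<rightarrow>\<^sub>E {1..}. \<forall>u\<in>V. \<forall>v\<in>V. {u, v} \<in> E \<longrightarrow> \<kappa> u \<noteq> \<kappa> v}"

definition chromatic_sym :: "'v set \<Rightarrow> 'v set set \<Rightarrow> 'a :: comm_ring_1 mps" where
  "chromatic_sym V E = mps_infsum (\<lambda>\<kappa>. \<Prod>v\<in>V. mps_var (\<kappa> v)) (proper_colorings V E)"

lemma coeff_elem_sym:
  "mps_coeff (elem_sym k :: 'a :: comm_ring_1 mps) m =
    (if size m = k \<and> 0 \<notin># m \<and> (\<forall>i. count m i \<le> 1) then 1 else 0)"
proof -
  let ?S = "{A. A \<subseteq> {1..} \<and> finite A \<and> card A = k}"
  have c: "mps_coeff (\<Prod>i\<in>A. mps_var i :: 'a mps) m = (if m = mset_set A then 1 else 0)"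
    if "A \<in> ?S" for A
    using that coeff_prod_var[of A "\<lambda>i. i" m] by simp
  have eq: "mps_coeff (elem_sym k :: 'a mps) m = (\<Sum>A | A \<in> ?S \<and> m = mset_set A. 1)"
    unfolding elem_sym_def mps_infsum.rep_eq
    using c by (intro sum.cong) (auto split: if_splits)
  show ?thesis
  proof (cases "size m = k \<and> 0 \<notin># m \<and> (\<forall>i. count m i \<le> 1)")
    case True
    have m: "mset_set (set_mset m) = m"
    proof (rule multiset_eqI)
      fix i
      have "count m i \<le> 1" using True by blast
      then show "count (mset_set (set_mset m)) i = count m i"
        by (cases "count m i") (auto simp: count_mset_set' simp flip: count_greater_zero_iff)
    qed
    have "card (set_mset m) = k" using True m by (metis size_mset_set)
    moreover have "set_mset m \<subseteq> {1..}" using True by (auto simp: Suc_le_eq intro: gr0I)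
    ultimately have "set_mset m \<in> {A. A \<in> ?S \<and> m = mset_set A}"
      by (simp add: m)
    moreover have "A = set_mset m" if "A \<in> ?S" "m = mset_set A" for A
      using that by simp
    ultimately have "{A. A \<in> ?S \<and> m = mset_set A} = {set_mset m}" by blast
    then show ?thesis using eq True by simp
  next
    case False
    have "m \<noteq> mset_set A" if "A \<in> ?S" for A
      using that False by (auto simp: count_mset_set' split: if_splits)
    then have none: "{A. A \<in> ?S \<and> m = mset_set A} = {}" by blast
    show ?thesis unfolding eq none using False by auto
  qed
qed

lemma coeff_chromatic_sym:
  assumes "finite V"
  shows "finite {\<kappa> \<in> proper_colorings V E. image_mset \<kappa> (mset_set V) = m}"
    and "mps_coeff (chromatic_sym V E :: 'a :: comm_ring_1 mps) m =
      of_nat (card {\<kappa> \<in> proper_colorings V E. image_mset \<kappa> (mset_set V) = m})"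
proof -
  have "{\<kappa> \<in> proper_colorings V E. image_mset \<kappa> (mset_set V) = m} \<subseteq> V \<rightarrow>\<^sub>E set_mset m"
    using assms by (auto simp: proper_colorings_def PiE_def)
  then show "finite {\<kappa> \<in> proper_colorings V E. image_mset \<kappa> (mset_set V) = m}"
    using assms by (meson finite_PiE finite_set_mset finite_subset)
  have "mps_coeff (chromatic_sym V E :: 'a mps) m =
      (\<Sum>\<kappa> | \<kappa> \<in> proper_colorings V E \<and> image_mset \<kappa> (mset_set V) = m. 1)"
    unfolding chromatic_sym_def mps_infsum.rep_eq
    by (rule sum.cong) (auto simp: coeff_prod_var[OF assms])
  then show "mps_coeff (chromatic_sym V E :: 'a mps) m =
      of_nat (card {\<kappa> \<in> proper_colorings V E. image_mset \<kappa> (mset_set V) = m})"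
    by simp
qed


section \<open>Compositions\<close>

definition compositions :: "nat \<Rightarrow> nat list set" where
  "compositions n = {I. (\<forall>i\<in>set I. 1 \<le> i) \<and> sum_list I = n}"

lemma finite_compositions: "finite (compositions n)"
proof (rule finite_subset)
  have "length I \<le> sum_list I" if "\<forall>i\<in>set I. 1 \<le> i" for I :: "nat list"
    using that by (induction I) auto
  then show "compositions n \<subseteq> {I. set I \<subseteq> {..n} \<and> length I \<le> n}"
    by (auto simp: compositions_def member_le_sum_list)
  show "finite {I. set I \<subseteq> {..n} \<and> length I \<le> n}"
    by (rule finite_lists_length_le) simp
qed

definition comp_weight :: "nat list \<Rightarrow> rat" where
  "comp_weight I = of_nat (hd I) * (\<Prod>i\<leftarrow>tl I. of_nat i - 1)"

text \<open>Both are meant for \<open>c \<le> sum_list I\<close> only; the subtraction in \<open>Theta_plus\<close> is then exact.\<close>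

definition sigma_plus :: "nat list \<Rightarrow> nat \<Rightarrow> nat" where
  "sigma_plus I c = Min {sum_list (take k I) | k. k \<le> length I \<and> c \<le> sum_list (take k I)}"

definition Theta_plus :: "nat list \<Rightarrow> nat \<Rightarrow> nat" where
  "Theta_plus I c = sigma_plus I c - c"


section \<open>The generalized bull \<open>K(1\<^sup>a 2 1\<^bsup>n-a-2\<^esup>)\<close>\<close>

definition path_edges :: "nat \<Rightarrow> nat set set" where
  "path_edges n = {{i, i + 1} | i. 1 \<le> i \<and> i < n}"

definition bull_edges :: "nat \<Rightarrow> nat \<Rightarrow> nat set set" where
  "bull_edges a n = insert {a, a + 2} (path_edges n)"

end

theory Submission
  imports Defs "HOL-Computational_Algebra.Formal_Power_Series"
begin

text \<open>
  Write \<open>P\<^sub>n\<close> for the generating function of the words of length \<open>n\<close> with distinct neighbours, i.e.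
  for the chromatic symmetric function of the path. Inserting a letter between positions \<open>a\<close> and
  \<open>a + 1\<close> of a word of length \<open>n - 1\<close> shows that the bull has the chromatic symmetric function
  \<open>2 P\<^sub>n + e\<^sub>1 P\<^bsub>n-1\<^esub> - P\<^sub>a P\<^bsub>n-a\<^esub> - P\<^bsub>a+1\<^esub> P\<^bsub>n-a-1\<^esub>\<close>.
  A bijection on pairs (set, word) gives \<open>\<Sum>\<^sub>k k e\<^sub>k P\<^bsub>n-k\<^esub> = \<Sum>\<^bsub>k<n\<^esub> e\<^sub>k P\<^bsub>n-k\<^esub>\<close>, hence
  \<open>P = E C\<close> for the series \<open>C = 1 / (E - z E')\<close> with coefficients
  \<open>C\<^sub>n = \<Sum>\<^sub>I \<Prod>\<^sub>j (i\<^sub>j - 1) e\<^sub>I\<close>, which is the expansion \<open>P\<^sub>n = \<Sum>\<^sub>I w\<^sub>I e\<^sub>I\<close>.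
  Cutting a composition at the first partial sum that is at least \<open>a\<close>, the compositions with
  \<open>\<Theta>\<^sup>+(a) = t \<le> 1\<close> contribute \<open>P\<^bsub>a+t\<^esub> C\<^bsub>n-a-t\<^esub>\<close> to \<open>P\<^sub>n\<close>. With the factor
  \<open>(i - 2) / (i - 1)\<close> on the last part \<open>i \<ge> 3\<close>, the series \<open>C\<close> is replaced by
  \<open>2 C - P + e\<^sub>1 z C\<close> in positive degrees, and the theorem follows by comparing terms.
\<close>

section \<open>Generating functions of weighted sets\<close>

definition mps_gf :: "'b set \<Rightarrow> ('b \<Rightarrow> nat multiset) \<Rightarrow> 'a :: comm_ring_1 mps" where
  "mps_gf S f = Abs_mps (\<lambda>m. of_nat (card {x \<in> S. f x = m}))"

text \<open>The cardinality of an infinite set is 0 in HOL, so coefficients of \<open>mps_gf\<close>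
  are additive and multiplicative only for finite fibres.\<close>

definition finite_fibres :: "'b set \<Rightarrow> ('b \<Rightarrow> nat multiset) \<Rightarrow> bool" where
  "finite_fibres S f \<longleftrightarrow> (\<forall>m. finite {x \<in> S. f x = m})"

lemma coeff_mps_gf: "mps_coeff (mps_gf S f :: 'a :: comm_ring_1 mps) m = of_nat (card {x \<in> S. f x = m})"
  by (simp add: mps_gf_def Abs_mps_inverse)

lemma finite_fibres_mono:
  assumes "finite_fibres T f" "S \<subseteq> T"
  shows "finite_fibres S f"
proof -
  have "finite {x \<in> S. f x = m}" for m
    using assms by (intro finite_subset[of "{x \<in> S. f x = m}" "{x \<in> T. f x = m}"])
      (auto simp: finite_fibres_def)
  then show ?thesis by (simp add: finite_fibres_def)
qed

lemma mps_gf_bij: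
  assumes "bij_betw h S T" and wt: "\<And>x. x \<in> S \<Longrightarrow> g (h x) = f x"
  shows "(mps_gf S f :: 'a :: comm_ring_1 mps) = mps_gf T g"
proof (rule mps_eqI)
  fix m
  have "bij_betw h {x \<in> S. f x = m} {y \<in> T. g y = m}"
    using assms unfolding bij_betw_def by (auto simp: inj_on_def)
  then show "mps_coeff (mps_gf S f :: 'a mps) m = mps_coeff (mps_gf T g) m"
    by (simp add: coeff_mps_gf bij_betw_same_card)
qed

lemma mps_gf_Un:
  assumes "finite_fibres S f" "finite_fibres T f" "S \<inter> T = {}"
  shows "(mps_gf (S \<union> T) f :: 'a :: comm_ring_1 mps) = mps_gf S f + mps_gf T f"
proof (rule mps_eqI)
  fix m
  have "{x \<in> S \<union> T. f x = m} = {x \<in> S. f x = m} \<union> {x \<in> T. f x = m}" by auto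
  moreover have "card \<dots> = card {x \<in> S. f x = m} + card {x \<in> T. f x = m}"
    using assms by (intro card_Un_disjoint) (auto simp: finite_fibres_def)
  ultimately show "mps_coeff (mps_gf (S \<union> T) f :: 'a mps) m = mps_coeff (mps_gf S f + mps_gf T f) m"
    by (simp add: coeff_mps_gf plus_mps.rep_eq)
qed

text \<open>Sorting the pairs by the monomial \<open>a\<close> of the first component produces the
  index set of the product of power series.\<close>

lemma fibre_times:
  "{z \<in> S \<times> T. f (fst z) + g (snd z) = m} =
    (\<Union>a\<in>{a. a \<subseteq># m}. {x \<in> S. f x = a} \<times> {y \<in> T. g y = m - a})"
proof (intro equalityI subsetI)
  fix z assume "z \<in> (\<Union>a\<in>{a. a \<subseteq># m}. {x \<in> S. f x = a} \<times> {y \<in> T. g y = m - a})"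
  then show "z \<in> {z \<in> S \<times> T. f (fst z) + g (snd z) = m}"
    by (auto simp: subset_mset.add_diff_inverse)
qed auto

lemma finite_fibres_times:
  assumes "finite_fibres S f" "finite_fibres T g"
  shows "finite_fibres (S \<times> T) (\<lambda>z. f (fst z) + g (snd z))"
  unfolding finite_fibres_def fibre_times
  using assms by (auto simp: finite_fibres_def finite_submultisets)

lemma mps_gf_times:
  assumes "finite_fibres S f" "finite_fibres T g"
  shows "(mps_gf S f * mps_gf T g :: 'a :: comm_ring_1 mps) = mps_gf (S \<times> T) (\<lambda>z. f (fst z) + g (snd z))"
proof (rule mps_eqI)
  fix m
  have "card {z \<in> S \<times> T. f (fst z) + g (snd z) = m} =
      (\<Sum>a | a \<subseteq># m. card ({x \<in> S. f x = a} \<times> {y \<in> T. g y = m - a}))"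
    unfolding fibre_times
    using assms by (intro card_UN_disjoint) (auto simp: finite_fibres_def finite_submultisets)
  then show "mps_coeff (mps_gf S f * mps_gf T g :: 'a mps) m =
      mps_coeff (mps_gf (S \<times> T) (\<lambda>z. f (fst z) + g (snd z))) m"
    by (simp add: coeff_mps_gf times_mps.rep_eq card_cartesian_product)
qed

lemma mps_gf_empty [simp]: "mps_gf {} f = (0 :: 'a :: comm_ring_1 mps)"
  by (rule mps_eqI) (simp add: coeff_mps_gf zero_mps.rep_eq)

section \<open>Elementary symmetric functions as generating functions of sets\<close>

definition pos_sets :: "nat \<Rightarrow> nat set set" where
  "pos_sets k = {A. finite A \<and> 0 \<notin> A \<and> card A = k}"

lemma finite_fibres_mset_set: "finite_fibres (pos_sets k) mset_set"
proof -
  have "finite {A \<in> pos_sets k. mset_set A = m}" for m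
    by (rule finite_subset[of _ "{set_mset m}"]) (auto simp: pos_sets_def)
  then show ?thesis by (simp add: finite_fibres_def)
qed

lemma finite_fibres_mset: "finite_fibres S mset"
proof -
  have "finite {w \<in> S. mset w = m}" for m :: "nat multiset"
    by (rule finite_subset[of _ "{w. set w \<subseteq> set_mset m \<and> length w = size m}"])
      (auto intro: finite_lists_length_eq)
  then show ?thesis by (simp add: finite_fibres_def)
qed

lemma elem_sym_eq_gf: "(elem_sym k :: 'a :: comm_ring_1 mps) = mps_gf (pos_sets k) mset_set"
proof (rule mps_eqI)
  fix m
  have "mps_coeff (elem_sym k :: 'a mps) m =
      (\<Sum>A | A \<in> {A. A \<subseteq> {1..} \<and> finite A \<and> card A = k} \<and>
        mset_set A = m. 1)"
    unfolding elem_sym_def mps_infsum.rep_eq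
    by (intro sum.cong) (auto simp: coeff_prod_var[where k = "\<lambda>i. i", simplified] split: if_splits)
  also have "\<dots> = (\<Sum>A | A \<in> pos_sets k \<and> mset_set A = m. 1)"
    by (intro sum.cong) (auto simp: pos_sets_def Suc_le_eq intro!: gr0I)
  also have "\<dots> = mps_coeff (mps_gf (pos_sets k) mset_set) m"
    by (simp add: coeff_mps_gf)
  finally show "mps_coeff (elem_sym k :: 'a mps) m = mps_coeff (mps_gf (pos_sets k) mset_set) m" .
qed

lemma elem_sym_0 [simp]: "elem_sym 0 = (1 :: 'a :: comm_ring_1 mps)"
proof (rule mps_eqI)
  show "mps_coeff (elem_sym 0 :: 'a mps) m = mps_coeff 1 m" for m
    by (cases "m = {#}") (simp_all add: coeff_elem_sym one_mps.rep_eq)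
qed


section \<open>Words without equal neighbours\<close>

text \<open>These words are the proper colorings of a path, read along the path; the letter 0 is
  excluded because colors start at 1.\<close>

definition smirnov :: "nat \<Rightarrow> nat list set" where
  "smirnov n = {w. length w = n \<and> 0 \<notin> set w \<and> distinct_adj w}"

definition path_sym :: "nat \<Rightarrow> 'a :: comm_ring_1 mps" where
  "path_sym n = mps_gf (smirnov n) mset"

lemma path_sym_0 [simp]: "path_sym 0 = (1 :: 'a :: comm_ring_1 mps)"
proof (rule mps_eqI)
  fix m
  have "{w \<in> smirnov 0. mset w = m} = (if m = {#} then {[]} else {})"
    by (auto simp: smirnov_def)
  then show "mps_coeff (path_sym 0 :: 'a mps) m = mps_coeff 1 m"
    by (simp add: path_sym_def coeff_mps_gf one_mps.rep_eq)
qed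

text \<open>One-letter words and one-element sets both amount to a positive integer. This allows a
  factor \<open>elem_sym 1\<close> to be treated as a letter to insert.\<close>

lemma path_sym_1: "path_sym 1 = (elem_sym 1 :: 'a :: comm_ring_1 mps)"
proof -
  have smirnov: "smirnov 1 = (\<lambda>x. [x]) ` (- {0})"
  proof (rule set_eqI)
    show "w \<in> smirnov 1 \<longleftrightarrow> w \<in> (\<lambda>x. [x]) ` (- {0})" for w
      by (cases w) (auto simp: smirnov_def image_iff)
  qed
  have pos_sets: "pos_sets 1 = (\<lambda>x. {x}) ` (- {0})"
    by (auto simp: pos_sets_def card_1_singleton_iff)
  have "(mps_gf (smirnov 1) mset :: 'a mps) = mps_gf (- {0}) (\<lambda>x. {#x#})"
    unfolding smirnov
    by (rule mps_gf_bij[symmetric, where h = "\<lambda>x. [x]"]) (auto simp: bij_betw_def inj_on_def)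
  also have "\<dots> = mps_gf (pos_sets 1) mset_set"
    unfolding pos_sets
    by (rule mps_gf_bij[where h = "\<lambda>x. {x}"]) (auto simp: bij_betw_def inj_on_def)
  finally show ?thesis unfolding path_sym_def elem_sym_eq_gf .
qed

section \<open>Pairs of a set and a word, and the recursion for paths\<close>

definition set_words :: "nat \<Rightarrow> nat \<Rightarrow> (nat set \<times> nat list) set" where
  "set_words k l = pos_sets k \<times> smirnov l"

definition set_word_wt :: "nat set \<times> nat list \<Rightarrow> nat multiset" where
  "set_word_wt z = mset_set (fst z) + mset (snd z)"

lemma elem_sym_times_path_sym:
  "elem_sym k * path_sym l = (mps_gf (set_words k l) set_word_wt :: 'a :: comm_ring_1 mps)"
  unfolding elem_sym_eq_gf path_sym_def set_words_def set_word_wt_def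
  by (rule mps_gf_times[OF finite_fibres_mset_set finite_fibres_mset])

lemma finite_fibres_set_words: "finite_fibres (set_words k l) set_word_wt"
  unfolding set_words_def set_word_wt_def
  by (rule finite_fibres_times[OF finite_fibres_mset_set finite_fibres_mset])

text \<open>The empty word falls into neither class, so that the boundary term at
  \<open>l = 0\<close> vanishes in the recursion.\<close>

definition hd_in :: "nat \<Rightarrow> nat \<Rightarrow> (nat set \<times> nat list) set" where
  "hd_in k l = {(A, w) \<in> set_words k l. w \<noteq> [] \<and> hd w \<in> A}"

definition hd_notin :: "nat \<Rightarrow> nat \<Rightarrow> (nat set \<times> nat list) set" where
  "hd_notin k l = {(A, w) \<in> set_words k l. w \<noteq> [] \<and> hd w \<notin> A}"

lemma elem_sym_times_path_sym_Suc:
  "elem_sym k * path_sym (Suc l) =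
    (mps_gf (hd_in k (Suc l)) set_word_wt + mps_gf (hd_notin k (Suc l)) set_word_wt :: 'a :: comm_ring_1 mps)"
proof -
  have "set_words k (Suc l) = hd_in k (Suc l) \<union> hd_notin k (Suc l)"
    by (auto simp: hd_in_def hd_notin_def set_words_def smirnov_def)
  moreover have "mps_gf (hd_in k (Suc l) \<union> hd_notin k (Suc l)) set_word_wt =
    (mps_gf (hd_in k (Suc l)) set_word_wt + mps_gf (hd_notin k (Suc l)) set_word_wt :: 'a mps)"
    by (intro mps_gf_Un finite_fibres_mono[OF finite_fibres_set_words[of k "Suc l"]])
      (auto simp: hd_in_def hd_notin_def)
  ultimately show ?thesis by (simp add: elem_sym_times_path_sym)
qed

text \<open>The factor \<open>k\<close> counts the choices of a marked element of the set; the mark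
  does not change the monomial.\<close>

lemma mps_gf_marked:
  "mps_gf (SIGMA z : set_words k l. fst z) (\<lambda>y. set_word_wt (fst y)) =
    (of_nat k * mps_gf (set_words k l) set_word_wt :: 'a :: comm_ring_1 mps)"
proof (rule mps_eqI)
  fix m
  have coeff: "mps_coeff (of_nat k * g) m = of_nat k * mps_coeff g m" for g :: "'a mps"
    by (induction k) (simp_all add: zero_mps.rep_eq plus_mps.rep_eq algebra_simps)
  have "{y \<in> (SIGMA z : set_words k l. fst z). set_word_wt (fst y) = m} =
      (SIGMA z : {z \<in> set_words k l. set_word_wt z = m}. fst z)" by auto
  moreover have "card \<dots> = (\<Sum>z | z \<in> set_words k l \<and> set_word_wt z = m. card (fst z))"
    using finite_fibres_set_words[of k l]
    by (intro card_SigmaI) (auto simp: finite_fibres_def set_words_def pos_sets_def)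
  moreover have "\<dots> = (\<Sum>z | z \<in> set_words k l \<and> set_word_wt z = m. k)"
    by (intro sum.cong) (auto simp: set_words_def pos_sets_def)
  ultimately show "mps_coeff (mps_gf (SIGMA z : set_words k l. fst z) (\<lambda>y. set_word_wt (fst y)) :: 'a mps) m =
      mps_coeff (of_nat k * mps_gf (set_words k l) set_word_wt) m"
    by (simp add: coeff coeff_mps_gf mult.commute)
qed

lemma finite_fibres_marked:
  "finite_fibres (SIGMA z : set_words k l. fst z) (\<lambda>y. set_word_wt (fst y))"
proof -
  have "{y \<in> (SIGMA z : set_words k l. fst z). set_word_wt (fst y) = m} =
      (SIGMA z : {z \<in> set_words k l. set_word_wt z = m}. fst z)" for m by auto
  then show ?thesis
    using finite_fibres_set_words[of k l]
    by (auto simp: finite_fibres_def set_words_def pos_sets_def intro!: finite_SigmaI)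
qed

text \<open>
  A marked element of the set that differs from the first letter of the word is moved to the front
  of the word; if it equals the first letter, the mark is redundant.
\<close>

lemma marked_elem_sym_times_path_sym:
  "of_nat (Suc k) * (elem_sym (Suc k) * path_sym l) =
    (mps_gf (hd_in (Suc k) l) set_word_wt + mps_gf (hd_notin k (Suc l)) set_word_wt :: 'a :: comm_ring_1 mps)"
proof -
  let ?S = "SIGMA z : set_words (Suc k) l. fst z"
  let ?f = "\<lambda>y :: (nat set \<times> nat list) \<times> nat. set_word_wt (fst y)"
  define S1 where "S1 = {((A, w), x) \<in> ?S. w \<noteq> [] \<and> hd w = x}"
  \<comment> \<open>Pairs with empty word belong here: there is no first letter for the mark to
    equal.\<close>
  define S2 where "S2 = {((A, w), x) \<in> ?S. \<not> (w \<noteq> [] \<and> hd w = x)}"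
  have "of_nat (Suc k) * (elem_sym (Suc k) * path_sym l) = (mps_gf ?S ?f :: 'a mps)"
    by (simp only: elem_sym_times_path_sym mps_gf_marked)
  also have "?S = S1 \<union> S2" by (auto simp: S1_def S2_def)
  also have "mps_gf (S1 \<union> S2) ?f = (mps_gf S1 ?f + mps_gf S2 ?f :: 'a mps)"
    by (intro mps_gf_Un finite_fibres_mono[OF finite_fibres_marked[of "Suc k" l]])
      (auto simp: S1_def S2_def)
  also have "(mps_gf S1 ?f :: 'a mps) = mps_gf (hd_in (Suc k) l) set_word_wt"
    by (rule mps_gf_bij[where h = fst])
      (auto simp: bij_betw_def inj_on_def S1_def hd_in_def image_iff)
  also have "(mps_gf S2 ?f :: 'a mps) = mps_gf (hd_notin k (Suc l)) set_word_wt"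
  \<comment> \<open>Since the mark \<open>x\<close> differs from the first letter of
    \<open>w\<close>, the word \<open>x # w\<close> has distinct neighbors, and its head is missing
    from \<open>A - {x}\<close>. Conversely, the head of a word in \<open>hd_notin\<close> can be
    put back into the set as the mark.\<close>
  proof (rule mps_gf_bij[where h = "\<lambda>((A, w), x). (A - {x}, x # w)"])
    show "bij_betw (\<lambda>((A, w), x). (A - {x}, x # w)) S2 (hd_notin k (Suc l))"
    proof (rule bij_betw_byWitness[where f' = "\<lambda>(A, w). ((insert (hd w) A, tl w), hd w)"])
      show "\<forall>y\<in>S2. (\<lambda>(A, w). ((insert (hd w) A, tl w), hd w)) ((\<lambda>((A, w), x). (A - {x}, x # w)) y) = y"
        by (auto simp: S2_def)
      show "\<forall>y\<in>hd_notin k (Suc l). (\<lambda>((A, w), x). (A - {x}, x # w)) ((\<lambda>(A, w). ((insert (hd w) A, tl w), hd w)) y) = y"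
        by (auto simp: hd_notin_def)
      show "(\<lambda>((A, w), x). (A - {x}, x # w)) ` S2 \<subseteq> hd_notin k (Suc l)"
        by (auto simp: S2_def hd_notin_def set_words_def smirnov_def pos_sets_def distinct_adj_Cons)
      show "(\<lambda>(A, w). ((insert (hd w) A, tl w), hd w)) ` hd_notin k (Suc l) \<subseteq> S2"
      proof (clarify)
        fix A w assume "(A, w) \<in> hd_notin k (Suc l)"
        then show "((insert (hd w) A, tl w), hd w) \<in> S2"
          by (cases w) (auto simp: S2_def hd_notin_def set_words_def smirnov_def pos_sets_def distinct_adj_Cons)
      qed
    qed
    fix y assume "y \<in> S2"
    then show "set_word_wt ((\<lambda>((A, w), x). (A - {x}, x # w)) y) = set_word_wt (fst y)"
      by (auto simp: S2_def set_word_wt_def set_words_def pos_sets_def mset_set.remove)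
  qed
  finally show ?thesis .
qed

text \<open>With \<open>T\<close> and \<open>N\<close> for the contributions of \<open>hd_in\<close>
  and \<open>hd_notin\<close>, the weighted term of index \<open>k + 1\<close> is
  \<open>T (k + 1) + N k\<close>, the unweighted term of index \<open>k\<close> is
  \<open>T k + N k\<close>. The sums agree because \<open>T\<close> vanishes at both ends.\<close>

lemma path_sym_rec:
  "(\<Sum>k\<le>n. of_nat k * elem_sym k * path_sym (n - k)) =
    (\<Sum>k<n. elem_sym k * path_sym (n - k) :: 'a :: comm_ring_1 mps)"
proof -
  define T :: "nat \<Rightarrow> 'a mps" where "T k = mps_gf (hd_in k (n - k)) set_word_wt" for k
  define N :: "nat \<Rightarrow> 'a mps" where "N k = mps_gf (hd_notin k (n - k)) set_word_wt" for k
  have "hd_in 0 n = {}" "hd_in n 0 = {}"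
    by (auto simp: hd_in_def set_words_def pos_sets_def smirnov_def)
  then have T0: "T 0 = 0" and Tn: "T n = 0" by (simp_all add: T_def)
  have "(\<Sum>k\<le>n. of_nat k * elem_sym k * path_sym (n - k)) =
      (\<Sum>k<n. of_nat (Suc k) * elem_sym (Suc k) * path_sym (n - Suc k) :: 'a mps)"
    unfolding lessThan_Suc_atMost[symmetric] sum.lessThan_Suc_shift by simp
  also have "\<dots> = (\<Sum>k<n. T (Suc k) + N k)"
    by (intro sum.cong) (simp_all only: T_def N_def mult.assoc marked_elem_sym_times_path_sym lessThan_iff Suc_diff_Suc)
  also have "\<dots> = (\<Sum>k<n. T (Suc k)) + (\<Sum>k<n. N k)" by (rule sum.distrib)
  also have "(\<Sum>k<n. T (Suc k)) = (\<Sum>k<n. T k)"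
    using sum.lessThan_Suc_shift[of T n] by (simp add: T0 Tn)
  also have "(\<Sum>k<n. T k) + (\<Sum>k<n. N k) = (\<Sum>k<n. T k + N k)" by (simp add: sum.distrib)
  also have "\<dots> = (\<Sum>k<n. elem_sym k * path_sym (n - k))"
  proof (intro sum.cong refl)
    fix k assume "k \<in> {..<n}"
    then obtain l where "n - k = Suc l" by (metis Suc_diff_Suc lessThan_iff)
    then show "T k + N k = elem_sym k * path_sym (n - k)"
      by (simp only: T_def N_def elem_sym_times_path_sym_Suc)
  qed
  finally show ?thesis .
qed


section \<open>The bull in terms of paths\<close>

lemma smirnov_conv_nth:
  "w \<in> smirnov n \<longleftrightarrow> length w = n \<and> 0 \<notin> set w \<and> (\<forall>i. Suc i < n \<longrightarrow> w ! i \<noteq> w ! Suc i)"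
  by (auto simp: smirnov_def distinct_adj_conv_nth)

text \<open>The one pair of neighbors left free sits at the indices \<open>k - 1\<close> and
  \<open>k\<close>, on the two sides of a cut after \<open>k\<close> letters.\<close>

definition cut_words :: "nat \<Rightarrow> nat \<Rightarrow> nat list set" where
  "cut_words k n = {w. length w = n \<and> 0 \<notin> set w \<and> (\<forall>i. Suc i < n \<longrightarrow> Suc i \<noteq> k \<longrightarrow> w ! i \<noteq> w ! Suc i)}"

lemma path_sym_times_path_sym:
  assumes "k \<le> n"
  shows "path_sym k * path_sym (n - k) = (mps_gf (cut_words k n) mset :: 'a :: comm_ring_1 mps)"
proof -
  have "path_sym k * path_sym (n - k) =
      (mps_gf (smirnov k \<times> smirnov (n - k)) (\<lambda>z. mset (fst z) + mset (snd z)) :: 'a mps)"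
    unfolding path_sym_def by (intro mps_gf_times finite_fibres_mset)
  also have "\<dots> = mps_gf (cut_words k n) mset"
  proof (rule mps_gf_bij[where h = "\<lambda>(u, v). u @ v"])
    show "bij_betw (\<lambda>(u, v). u @ v) (smirnov k \<times> smirnov (n - k)) (cut_words k n)"
    proof (rule bij_betw_byWitness[where f' = "\<lambda>w. (take k w, drop k w)"])
      show "(\<lambda>(u, v). u @ v) ` (smirnov k \<times> smirnov (n - k)) \<subseteq> cut_words k n"
      proof clarify
        fix u v assume u: "u \<in> smirnov k" and v: "v \<in> smirnov (n - k)"
        have "(u @ v) ! i \<noteq> (u @ v) ! Suc i" if "Suc i < n" "Suc i \<noteq> k" for i
        proof (cases "Suc i < k")
          case True
          then show ?thesis using u by (auto simp: smirnov_conv_nth nth_append)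
        next
          case False
          with that have "k \<le> i" "Suc (i - k) < n - k" by auto
          with u v show ?thesis by (auto simp: smirnov_conv_nth nth_append Suc_diff_le)
        qed
        with u v assms show "u @ v \<in> cut_words k n" by (auto simp: smirnov_def cut_words_def)
      qed
      show "(\<lambda>w. (take k w, drop k w)) ` cut_words k n \<subseteq> smirnov k \<times> smirnov (n - k)"
        using assms by (auto simp: smirnov_conv_nth cut_words_def dest: in_set_takeD in_set_dropD)
    qed (auto simp: smirnov_def cut_words_def)
  qed auto
  finally show ?thesis .
qed

text \<open>Deleting the letter at index \<open>a\<close>, which belongs to the vertex
  \<open>a + 1\<close>, must leave a word with distinct neighbors; the last condition concerns the
  pair that becomes adjacent.\<close>

definition skip_words :: "nat \<Rightarrow> nat \<Rightarrow> nat list set" where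
  "skip_words a n = {w. length w = n \<and> 0 \<notin> set w \<and>
    (\<forall>i. Suc i < n \<longrightarrow> Suc i \<noteq> a \<longrightarrow> i \<noteq> a \<longrightarrow> w ! i \<noteq> w ! Suc i) \<and> w ! (a - 1) \<noteq> w ! Suc a}"

lemma elem_sym_1_times_path_sym:
  assumes "1 \<le> a" "a + 2 \<le> n"
  shows "elem_sym 1 * path_sym (n - 1) = (mps_gf (skip_words a n) mset :: 'a :: comm_ring_1 mps)"
proof -
  have "elem_sym 1 * path_sym (n - 1) =
      (mps_gf (smirnov 1 \<times> smirnov (n - 1)) (\<lambda>z. mset (fst z) + mset (snd z)) :: 'a mps)"
    unfolding path_sym_def path_sym_1[symmetric] by (intro mps_gf_times finite_fibres_mset)
  also have "\<dots> = mps_gf (skip_words a n) mset"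
  proof (rule mps_gf_bij[where h = "\<lambda>(u, v). take a v @ u @ drop a v"])
    show "bij_betw (\<lambda>(u, v). take a v @ u @ drop a v) (smirnov 1 \<times> smirnov (n - 1)) (skip_words a n)"
    proof (rule bij_betw_byWitness[where f' = "\<lambda>w. ([w ! a], take a w @ drop (Suc a) w)"])
      show "(\<lambda>(u, v). take a v @ u @ drop a v) ` (smirnov 1 \<times> smirnov (n - 1)) \<subseteq> skip_words a n"
      proof clarify
        fix u v assume u: "u \<in> smirnov 1" and v: "v \<in> smirnov (n - 1)"
        let ?w = "take a v @ u @ drop a v"
        have len: "length u = 1" "length v = n - 1" using u v by (auto simp: smirnov_def)
        have lo: "?w ! i = v ! i" if "i < a" for i
          using that len assms by (simp add: nth_append)
        \<comment> \<open>Behind the inserted letter, indices are shifted by one.\<close>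
        have hi: "?w ! i = v ! (i - 1)" if "a < i" "i < n" for i
        proof -
          have "a + (i - a - 1) = i - 1" using that by simp
          then show ?thesis using that len assms by (simp add: nth_append)
        qed
        have ad: "v ! i \<noteq> v ! Suc i" if "Suc i < n - 1" for i
          using v that by (auto simp: smirnov_conv_nth)
        have "?w ! i \<noteq> ?w ! Suc i" if "Suc i < n" "Suc i \<noteq> a" "i \<noteq> a" for i
        proof (cases "Suc i < a")
          case True
          then show ?thesis using ad[of i] lo assms by auto
        next
          case False
          with that have "a < i" by auto
          then show ?thesis using ad[of "i - 1"] hi[of i] hi[of "Suc i"] that by auto
        qed
        moreover have "?w ! (a - 1) \<noteq> ?w ! Suc a"
          using ad[of "a - 1"] lo[of "a - 1"] hi[of "Suc a"] assms by auto
        moreover have "0 \<notin> set ?w" using u v by (auto simp: smirnov_def dest: in_set_takeD in_set_dropD)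
        ultimately show "?w \<in> skip_words a n"
          using len assms by (simp add: skip_words_def)
      qed
      show "(\<lambda>w. ([w ! a], take a w @ drop (Suc a) w)) ` skip_words a n \<subseteq> smirnov 1 \<times> smirnov (n - 1)"
      proof clarify
        fix w assume w: "w \<in> skip_words a n"
        let ?v = "take a w @ drop (Suc a) w"
        have len: "length w = n" using w by (simp add: skip_words_def)
        have "?v ! i \<noteq> ?v ! Suc i" if "Suc i < n - 1" for i
        proof -
          \<comment> \<open>The pair lies before the deleted letter, straddles it, or lies behind
            it; the straddling case is the condition on the indices \<open>a - 1\<close> and
            \<open>Suc a\<close>.\<close>
          consider "Suc i < a" | "Suc i = a" | "a \<le> i" by linarith
          then show ?thesis
            using w that len assms by cases (auto simp: skip_words_def nth_append Suc_diff_le)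
        qed
        then have "?v \<in> smirnov (n - 1)"
          using w len assms by (auto simp: smirnov_conv_nth skip_words_def dest: in_set_takeD in_set_dropD)
        moreover have "w ! a \<in> set w" using len assms by simp
        then have "w ! a \<noteq> 0" using w by (metis (mono_tags, lifting) mem_Collect_eq skip_words_def)
        ultimately show "[w ! a] \<in> smirnov 1 \<and> ?v \<in> smirnov (n - 1)"
          by (simp add: smirnov_def)
      qed
      show "\<forall>w\<in>skip_words a n. (\<lambda>(u, v). take a v @ u @ drop a v) ([w ! a], take a w @ drop (Suc a) w) = w"
        using assms by (auto simp: skip_words_def id_take_nth_drop[symmetric])
      show "\<forall>z\<in>smirnov 1 \<times> smirnov (n - 1). (\<lambda>w. ([w ! a], take a w @ drop (Suc a) w))
          ((\<lambda>(u, v). take a v @ u @ drop a v) z) = z"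
        using assms by (auto simp: smirnov_def nth_append length_Suc_conv)
    qed
    fix z :: "nat list \<times> nat list"
    show "mset ((\<lambda>(u, v). take a v @ u @ drop a v) z) = mset (fst z) + mset (snd z)"
    proof (cases z)
      case (Pair u v)
      have "mset (take a v) + mset (drop a v) = mset v" by (simp flip: mset_append)
      then show ?thesis by (simp add: Pair union_lcomm)
    qed
  qed
  finally show ?thesis .
qed

text \<open>Words are indexed from 0, so the indices \<open>a - 1\<close> and \<open>Suc a\<close>
  stand for the endpoints \<open>a\<close> and \<open>a + 2\<close> of the additional edge.\<close>

definition bull_words :: "nat \<Rightarrow> nat \<Rightarrow> nat list set" where
  "bull_words a n = {w \<in> smirnov n. w ! (a - 1) \<noteq> w ! Suc a}"

text \<open>
  Insert a letter \<open>y\<close> between positions \<open>a\<close> and \<open>a + 1\<close> of a word of length \<open>n - 1\<close> with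
  distinct neighbours: either \<open>y\<close> differs from both of its neighbours, or it equals exactly one.
\<close>

lemma mps_gf_bull_words:
  assumes "1 \<le> a" "a + 2 \<le> n"
  shows "(mps_gf (bull_words a n) mset :: 'a :: comm_ring_1 mps) =
    2 * path_sym n + elem_sym 1 * path_sym (n - 1) - path_sym a * path_sym (n - a)
      - path_sym (a + 1) * path_sym (n - (a + 1))"
proof -
  \<comment> \<open>\<open>D k\<close> consists of the words whose only equal neighbors are at the
    cut after \<open>k\<close> letters.\<close>
  define D where "D k = cut_words k n - smirnov n" for k
  have cut: "path_sym k * path_sym (n - k) = (path_sym n + mps_gf (D k) mset :: 'a mps)" if "k \<le> n" for k
  proof -
    have "cut_words k n = smirnov n \<union> D k"
      by (auto simp: D_def cut_words_def smirnov_conv_nth)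
    moreover have "mps_gf (smirnov n \<union> D k) mset = (mps_gf (smirnov n) mset + mps_gf (D k) mset :: 'a mps)"
      by (intro mps_gf_Un finite_fibres_mset) (auto simp: D_def)
    ultimately show ?thesis unfolding path_sym_times_path_sym[OF that] by (simp add: path_sym_def)
  qed
  have D: "D (Suc j) = {w. length w = n \<and> 0 \<notin> set w \<and> w ! j = w ! Suc j \<and>
      (\<forall>i. Suc i < n \<longrightarrow> i \<noteq> j \<longrightarrow> w ! i \<noteq> w ! Suc i)}" if "Suc j < n" for j
    using that by (auto simp: D_def cut_words_def smirnov_conv_nth)
  obtain b where b: "a = Suc b" using assms by (cases a) auto
  have Da: "D a = {w. length w = n \<and> 0 \<notin> set w \<and> w ! b = w ! a \<and>
      (\<forall>i. Suc i < n \<longrightarrow> i \<noteq> b \<longrightarrow> w ! i \<noteq> w ! Suc i)}"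
    using D[of b] assms b by simp
  have Da1: "D (a + 1) = {w. length w = n \<and> 0 \<notin> set w \<and> w ! a = w ! Suc a \<and>
      (\<forall>i. Suc i < n \<longrightarrow> i \<noteq> a \<longrightarrow> w ! i \<noteq> w ! Suc i)}"
    using D[of a] assms by simp
  have skip: "skip_words a n = {w. length w = n \<and> 0 \<notin> set w \<and>
    (\<forall>i. Suc i < n \<longrightarrow> i \<noteq> b \<longrightarrow> i \<noteq> a \<longrightarrow> w ! i \<noteq> w ! Suc i) \<and> w ! b \<noteq> w ! Suc a}"
    by (auto simp: skip_words_def b)
  have bull: "bull_words a n = {w. length w = n \<and> 0 \<notin> set w \<and>
    (\<forall>i. Suc i < n \<longrightarrow> w ! i \<noteq> w ! Suc i) \<and> w ! b \<noteq> w ! Suc a}"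
    by (auto simp: bull_words_def smirnov_conv_nth b)
  have n: "Suc a < n" "Suc b < n" "b \<noteq> a" "Suc b = a" using assms b by auto
  have sub: "skip_words a n \<subseteq> bull_words a n \<union> (D a \<union> D (a + 1))"
  proof
    fix w assume w: "w \<in> skip_words a n"
    show "w \<in> bull_words a n \<union> (D a \<union> D (a + 1))"
    proof (cases "w ! b = w ! a")
      case True
      then have "w \<in> D a" using w n by (auto simp: skip Da)
      then show ?thesis by simp
    next
      case F: False
      show ?thesis
      proof (cases "w ! a = w ! Suc a")
        case True
        then have "w \<in> D (a + 1)" using w n F unfolding skip Da1 by auto
        then show ?thesis by simp
      next
        case False
        then have "w \<in> bull_words a n" using w n F unfolding skip bull by auto
        then show ?thesis by simp
      qed
    qed
  qed
  have "bull_words a n \<subseteq> skip_words a n" by (auto simp: bull skip)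
  moreover have "D a \<subseteq> skip_words a n"
  proof
    fix w assume w: "w \<in> D a"
    \<comment> \<open>The inserted letter equals its left neighbor and differs from its right one,
      so those two neighbors differ from each other.\<close>
    then have "w ! b = w ! a" "w ! a \<noteq> w ! Suc a" using n(1,3) unfolding Da by blast+
    then have "w ! b \<noteq> w ! Suc a" by simp
    with w show "w \<in> skip_words a n" unfolding Da skip by blast
  qed
  moreover have "D (a + 1) \<subseteq> skip_words a n"
  proof
    fix w assume w: "w \<in> D (a + 1)"
    then have "w ! b \<noteq> w ! Suc b" "w ! a = w ! Suc a" using n(2,3) unfolding Da1 by blast+
    then have "w ! b \<noteq> w ! Suc a" using n(4) by simp
    with w show "w \<in> skip_words a n" unfolding Da1 skip by blast
  qed
  ultimately have "skip_words a n = bull_words a n \<union> (D a \<union> D (a + 1))" using sub by blast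
  moreover have "mps_gf (bull_words a n \<union> (D a \<union> D (a + 1))) mset =
      (mps_gf (bull_words a n) mset + mps_gf (D a \<union> D (a + 1)) mset :: 'a mps)"
    by (intro mps_gf_Un finite_fibres_mset) (auto simp: D_def bull_words_def)
  moreover have "mps_gf (D a \<union> D (a + 1)) mset = (mps_gf (D a) mset + mps_gf (D (a + 1)) mset :: 'a mps)"
  proof (intro mps_gf_Un finite_fibres_mset)
    show "D a \<inter> D (a + 1) = {}" using n(1,3) unfolding Da Da1 by blast
  qed
  ultimately have "elem_sym 1 * path_sym (n - 1) =
      (mps_gf (bull_words a n) mset + (mps_gf (D a) mset + mps_gf (D (a + 1)) mset) :: 'a mps)"
    using elem_sym_1_times_path_sym[OF assms, where 'a = 'a] by simp
  \<comment> \<open>Replacing each of the two \<open>D\<close> terms by a product of path functions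
    minus \<open>path_sym n\<close> yields the coefficient 2.\<close>
  then show ?thesis
    using cut[of a] cut[of "a + 1"] assms by (simp add: algebra_simps)
qed

section \<open>Colorings of the bull as words\<close>

lemma bull_edges_iff:
  assumes "1 \<le> a" "a + 2 \<le> n" "u \<in> {1..n}" "v \<in> {1..n}"
  shows "{u, v} \<in> bull_edges a n \<longleftrightarrow>
    v = Suc u \<or> u = Suc v \<or> u = a \<and> v = a + 2 \<or> v = a \<and> u = a + 2"
  using assms by (auto simp: bull_edges_def path_edges_def doubleton_eq_iff)

lemma chromatic_sym_bull:
  assumes "1 \<le> a" "a + 2 \<le> n"
  shows "(chromatic_sym {1..n} (bull_edges a n) :: 'a :: comm_ring_1 mps) = mps_gf (bull_words a n) mset"
proof -
  let ?P = "proper_colorings {1..n} (bull_edges a n)"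
  have "chromatic_sym {1..n} (bull_edges a n) =
      (mps_gf ?P (\<lambda>\<kappa>. image_mset \<kappa> (mset_set {1..n})) :: 'a mps)"
    by (rule mps_eqI) (simp add: coeff_chromatic_sym coeff_mps_gf)
  also have "\<dots> = mps_gf (bull_words a n) mset"
  proof (rule mps_gf_bij[where h = "\<lambda>\<kappa>. map \<kappa> [1..<Suc n]"])
    show "bij_betw (\<lambda>\<kappa>. map \<kappa> [1..<Suc n]) ?P (bull_words a n)"
    \<comment> \<open>The restriction makes the coloring extensional, as membership in
      \<open>proper_colorings\<close> demands; vertex \<open>v\<close> has index
      \<open>v - 1\<close>.\<close>
    proof (rule bij_betw_byWitness[where f' = "\<lambda>w. restrict (\<lambda>v. w ! (v - 1)) {1..n}"])
      show "\<forall>\<kappa>\<in>?P. restrict (\<lambda>v. map \<kappa> [1..<Suc n] ! (v - 1)) {1..n} = \<kappa>"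
      proof (intro ballI ext)
        fix \<kappa> v assume "\<kappa> \<in> ?P"
        then show "restrict (\<lambda>v. map \<kappa> [1..<Suc n] ! (v - 1)) {1..n} v = \<kappa> v"
          by (auto simp: proper_colorings_def PiE_def extensional_def restrict_def nth_append simp del: upt_Suc)
      qed
      show "\<forall>w\<in>bull_words a n. map (restrict (\<lambda>v. w ! (v - 1)) {1..n}) [1..<Suc n] = w"
        by (auto simp: bull_words_def smirnov_def intro!: nth_equalityI simp del: upt_Suc)
      show "(\<lambda>\<kappa>. map \<kappa> [1..<Suc n]) ` ?P \<subseteq> bull_words a n"
      proof clarify
        fix \<kappa> assume k: "\<kappa> \<in> ?P"
        then have ne: "\<kappa> u \<noteq> \<kappa> v" if "{u, v} \<in> bull_edges a n" "u \<in> {1..n}" "v \<in> {1..n}" for u v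
          using that by (auto simp: proper_colorings_def)
        have "\<kappa> (Suc i) \<noteq> \<kappa> (Suc (Suc i))" if "Suc i < n" for i
          using that by (intro ne) (auto simp: bull_edges_iff[OF assms])
        moreover have "\<kappa> a \<noteq> \<kappa> (a + 2)"
          using assms by (intro ne) (auto simp: bull_edges_iff[OF assms])
        moreover have "\<kappa> v \<noteq> 0" if "v \<in> {1..n}" for v
          using k that PiE_mem[of \<kappa> "{1..n}" "\<lambda>_. {1..}" v] by (simp add: proper_colorings_def)
        then have "0 \<notin> set (map \<kappa> [1..<Suc n])"
          by (fastforce simp del: upt_Suc simp: less_Suc_eq_le)
        moreover have nth: "map \<kappa> [1..<Suc n] ! i = \<kappa> (Suc i)" if "i < n" for i
          using that by (simp del: upt_Suc)
        ultimately show "map \<kappa> [1..<Suc n] \<in> bull_words a n"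
          using assms nth[of "a - 1"] nth[of "Suc a"]
          by (auto simp: bull_words_def smirnov_conv_nth simp del: upt_Suc set_map)
      qed
      show "(\<lambda>w. restrict (\<lambda>v. w ! (v - 1)) {1..n}) ` bull_words a n \<subseteq> ?P"
      proof clarify
        fix w assume w: "w \<in> bull_words a n"
        then have len: "length w = n" and ad: "\<And>i. Suc i < n \<Longrightarrow> w ! i \<noteq> w ! Suc i"
          and aa: "w ! (a - 1) \<noteq> w ! Suc a" and pos: "0 \<notin> set w"
          by (auto simp: bull_words_def smirnov_conv_nth)
        have "w ! (u - 1) \<noteq> w ! (v - 1)" if "u \<in> {1..n}" "v \<in> {1..n}" "{u, v} \<in> bull_edges a n" for u v
          using that aa ad[of "u - 1"] ad[of "v - 1"] by (auto simp: bull_edges_iff[OF assms])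
        moreover have "1 \<le> w ! (v - 1)" if "v \<in> {1..n}" for v
        proof -
          have "w ! (v - 1) \<in> set w" using that len by (intro nth_mem) auto
          with pos show ?thesis by (metis One_nat_def Suc_leI gr0I)
        qed
        ultimately show "restrict (\<lambda>v. w ! (v - 1)) {1..n} \<in> ?P"
          by (auto simp: proper_colorings_def)
      qed
    qed
    fix \<kappa> :: "nat \<Rightarrow> nat"
    have "mset [1..<Suc n] = mset_set {1..n}"
      by (simp add: atLeastLessThanSuc_atLeastAtMost del: upt_Suc)
    then show "mset (map \<kappa> [1..<Suc n]) = image_mset \<kappa> (mset_set {1..n})"
      by (simp del: upt_Suc)
  qed
  finally show ?thesis .
qed


section \<open>Sums over compositions\<close>

lemma mps_scale_simps:
  fixes c d :: "'a :: comm_ring_1"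
  shows "1 *\<^sub>\<Lambda> f = f" "(c - d) *\<^sub>\<Lambda> f = c *\<^sub>\<Lambda> f - d *\<^sub>\<Lambda> f" "(c * d) *\<^sub>\<Lambda> f = c *\<^sub>\<Lambda> (d *\<^sub>\<Lambda> f)"
  by (rule mps_eqI; simp add: minus_mps.rep_eq algebra_simps)+

lemma mps_scale_mult: "(c * d) *\<^sub>\<Lambda> (f * g) = (c *\<^sub>\<Lambda> f) * (d *\<^sub>\<Lambda> g)"
  by (rule mps_eqI) (simp add: times_mps.rep_eq sum_distrib_left algebra_simps)

lemma mps_scale_of_nat: "of_nat k *\<^sub>\<Lambda> f = of_nat k * f"
proof (rule mps_eqI)
  show "mps_coeff (of_nat k *\<^sub>\<Lambda> f) m = mps_coeff (of_nat k * f) m" for m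
    by (induction k) (simp_all add: zero_mps.rep_eq plus_mps.rep_eq algebra_simps)
qed

lemma compositions_0: "compositions 0 = {[]}"
proof (intro equalityI subsetI)
  fix I assume "I \<in> compositions 0"
  then show "I \<in> {[]}" by (cases I) (auto simp: compositions_def)
qed (auto simp: compositions_def)

lemma sum_compositions_Cons:
  assumes "1 \<le> n"
  shows "(\<Sum>I\<in>compositions n. \<phi> I) = (\<Sum>k=1..n. \<Sum>L\<in>compositions (n - k). \<phi> (k # L))"
proof -
  have ne: "I \<noteq> []" if "I \<in> compositions n" for I using that assms by (auto simp: compositions_def)
  have "(\<Sum>I\<in>compositions n. \<phi> I) = (\<Sum>(k, L)\<in>(SIGMA k:{1..n}. compositions (n - k)). \<phi> (k # L))"
  proof (rule sum.reindex_bij_witness[where i = "\<lambda>(k, L). k # L" and j = "\<lambda>I. (hd I, tl I)"])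
    fix I assume "I \<in> compositions n"
    with ne[OF this] show "(hd I, tl I) \<in> (SIGMA k:{1..n}. compositions (n - k))"
      by (cases I) (auto simp: compositions_def)
  qed (use ne in \<open>auto simp: compositions_def\<close>)
  then show ?thesis by (simp add: sum.Sigma finite_compositions)
qed

text \<open>Reversal permutes the compositions of a number and exchanges first and last
  parts.\<close>

lemma sum_compositions_snoc:
  assumes "1 \<le> n"
  shows "(\<Sum>I\<in>compositions n. \<phi> I) = (\<Sum>k=1..n. \<Sum>L\<in>compositions (n - k). \<phi> (L @ [k]))"
proof -
  have rev: "(\<Sum>I\<in>compositions m. \<psi> (rev I)) = (\<Sum>I\<in>compositions m. \<psi> I)"
    for m and \<psi> :: "nat list \<Rightarrow> 'a"
    by (rule sum.reindex_bij_witness[where i = rev and j = rev]) (auto simp: compositions_def)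
  have "(\<Sum>I\<in>compositions n. \<phi> I) = (\<Sum>I\<in>compositions n. \<phi> (rev I))" by (simp only: rev)
  also have "\<dots> = (\<Sum>k=1..n. \<Sum>L\<in>compositions (n - k). \<phi> (rev L @ [k]))"
    using sum_compositions_Cons[OF assms, of "\<lambda>I. \<phi> (rev I)"] by simp
  also have "\<dots> = (\<Sum>k=1..n. \<Sum>L\<in>compositions (n - k). \<phi> (L @ [k]))"
    by (intro sum.cong refl rev[of "\<lambda>L. \<phi> (L @ [_])"])
  finally show ?thesis .
qed

text \<open>The weight of a tail: every part counts \<open>i - 1\<close>, including the first, since
  the exceptional first part of \<open>comp_weight\<close> lies in the prefix.\<close>

definition part_weight :: "nat list \<Rightarrow> rat" where
  "part_weight L = (\<Prod>i\<leftarrow>L. of_nat i - 1)"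

definition comp_sym :: "nat \<Rightarrow> rat mps" where
  "comp_sym n = (\<Sum>L\<in>compositions n. part_weight L *\<^sub>\<Lambda> elem_sym_comp L)"

lemma comp_weight_append: "K \<noteq> [] \<Longrightarrow> comp_weight (K @ L) = comp_weight K * part_weight L"
  by (cases K) (auto simp: comp_weight_def part_weight_def)

lemma elem_sym_comp_append: "elem_sym_comp (K @ L) = elem_sym_comp K * elem_sym_comp L"
  by (simp add: elem_sym_comp_def)

lemma elem_sym_comp_single [simp]: "elem_sym_comp [k] = elem_sym k"
  by (simp add: elem_sym_comp_def)

lemma comp_sym_0: "comp_sym 0 = 1"
  by (simp add: comp_sym_def compositions_0 part_weight_def elem_sym_comp_def mps_scale_simps)

lemma comp_sym_rec:
  assumes "1 \<le> n"
  shows "comp_sym n = (\<Sum>k=1..n. (of_nat k * elem_sym k - elem_sym k) * comp_sym (n - k))"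
proof -
  have "part_weight (k # L) *\<^sub>\<Lambda> elem_sym_comp (k # L) =
      (of_nat k * elem_sym k - elem_sym k) * (part_weight L *\<^sub>\<Lambda> elem_sym_comp L)" for k L
    using mps_scale_mult[of "of_nat k - 1" "part_weight L" "elem_sym k" "elem_sym_comp L"]
    by (simp add: part_weight_def elem_sym_comp_def mps_scale_simps(1,2) mps_scale_of_nat)
  then show ?thesis
    unfolding comp_sym_def sum_compositions_Cons[OF assms] by (simp add: sum_distrib_left)
qed

section \<open>Generating series in the degree\<close>

definition elem_fps :: "rat mps fps" where "elem_fps = Abs_fps elem_sym"
definition elem_deriv_fps :: "rat mps fps" where "elem_deriv_fps = Abs_fps (\<lambda>k. of_nat k * elem_sym k)"
definition comp_fps :: "rat mps fps" where "comp_fps = Abs_fps comp_sym"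
definition path_fps :: "rat mps fps" where "path_fps = Abs_fps path_sym"

text \<open>Removing the first part of a composition gives the recursion
  \<open>comp_sym_rec\<close>, which is the one satisfied by the inverse of a series with constant
  term 1.\<close>

lemma comp_fps_inverse: "(elem_fps - elem_deriv_fps) * comp_fps = 1"
proof (rule fps_ext)
  fix n
  let ?f = "\<lambda>k. (elem_sym k - of_nat k * elem_sym k) * comp_sym (n - k)"
  have "fps_nth ((elem_fps - elem_deriv_fps) * comp_fps) n = (\<Sum>k=0..n. ?f k)"
    by (simp add: fps_mult_nth elem_fps_def elem_deriv_fps_def comp_fps_def)
  also have "\<dots> = comp_sym n + (\<Sum>k=1..n. ?f k)" by (simp add: sum.atLeast_Suc_atMost)
  also have "\<dots> = fps_nth 1 n"
  proof (cases "n = 0")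
    case True
    then show ?thesis by (simp add: comp_sym_0)
  next
    case False
    then have "comp_sym n = - (\<Sum>k=1..n. ?f k)"
      by (subst comp_sym_rec) (auto simp: sum_negf[symmetric] algebra_simps)
    then show ?thesis using False by simp
  qed
  finally show "fps_nth ((elem_fps - elem_deriv_fps) * comp_fps) n = fps_nth 1 n" .
qed

lemma path_fps_eq: "path_fps = elem_fps * comp_fps"
proof -
  have "elem_deriv_fps * path_fps = elem_fps * path_fps - elem_fps"
  proof (rule fps_ext)
    fix n
    have "fps_nth (elem_deriv_fps * path_fps) n = (\<Sum>k\<le>n. of_nat k * elem_sym k * path_sym (n - k))"
      by (simp add: fps_mult_nth elem_deriv_fps_def path_fps_def atLeast0AtMost)
    also have "\<dots> = (\<Sum>k<n. elem_sym k * path_sym (n - k))" by (rule path_sym_rec)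
    \<comment> \<open>The missing term at \<open>k = n\<close> is
      \<open>elem_sym n * path_sym 0\<close>, hence the subtraction of
      \<open>elem_fps\<close>.\<close>
    also have "\<dots> = (\<Sum>k\<le>n. elem_sym k * path_sym (n - k)) - elem_sym n"
      by (simp add: lessThan_Suc_atMost[symmetric])
    finally show "fps_nth (elem_deriv_fps * path_fps) n = fps_nth (elem_fps * path_fps - elem_fps) n"
      by (simp add: fps_mult_nth elem_fps_def path_fps_def atLeast0AtMost)
  qed
  then have "(elem_fps - elem_deriv_fps) * path_fps = elem_fps" by (simp add: algebra_simps)
  then have "elem_fps * comp_fps = (elem_fps - elem_deriv_fps) * comp_fps * path_fps"
    by (metis mult.assoc mult.commute)
  then show ?thesis by (simp add: comp_fps_inverse)
qed

lemma elem_deriv_comp_fps: "elem_deriv_fps * comp_fps = path_fps - 1"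
  using comp_fps_inverse path_fps_eq by (simp add: algebra_simps)

text \<open>The first part \<open>k\<close> has weight \<open>k\<close>, so it contributes
  \<open>elem_deriv_fps\<close> and the tail \<open>comp_fps\<close>; the product is
  \<open>path_fps - 1\<close>, which agrees with \<open>path_fps\<close> in positive degree.\<close>

lemma path_sym_eq_sum_compositions:
  assumes "1 \<le> n"
  shows "path_sym n = (\<Sum>I\<in>compositions n. comp_weight I *\<^sub>\<Lambda> elem_sym_comp I)"
proof -
  have scale: "comp_weight (k # L) *\<^sub>\<Lambda> elem_sym_comp (k # L) =
      of_nat k * elem_sym k * (part_weight L *\<^sub>\<Lambda> elem_sym_comp L)" for k L
    using mps_scale_mult[of "of_nat k" "part_weight L" "elem_sym k" "elem_sym_comp L"]
    by (simp add: part_weight_def comp_weight_def elem_sym_comp_def mps_scale_of_nat)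
  have "path_sym n = fps_nth (elem_deriv_fps * comp_fps) n"
    using assms by (simp add: elem_deriv_comp_fps path_fps_def)
  also have "\<dots> = (\<Sum>k=0..n. of_nat k * elem_sym k * comp_sym (n - k))"
    by (simp add: fps_mult_nth elem_deriv_fps_def comp_fps_def)
  also have "\<dots> = (\<Sum>k=1..n. of_nat k * elem_sym k * comp_sym (n - k))"
    by (simp add: sum.atLeast_Suc_atMost)
  also have "\<dots> = (\<Sum>I\<in>compositions n. comp_weight I *\<^sub>\<Lambda> elem_sym_comp I)"
    unfolding sum_compositions_Cons[OF assms] scale by (simp add: comp_sym_def sum_distrib_left)
  finally show ?thesis .
qed

text \<open>The tail's share of a summand of the first sum of the theorem. The condition on the last
  part is built in as a zero value, so that all tails can be summed.\<close>

definition last_term :: "nat list \<Rightarrow> rat mps" where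
  "last_term L = (if 3 \<le> last L
    then ((of_nat (last L) - 2) / (of_nat (last L) - 1) * part_weight L) *\<^sub>\<Lambda> elem_sym_comp L else 0)"

text \<open>The quotient turns the weight \<open>k - 1\<close> of the last part into
  \<open>k - 2\<close>. Splitting off that part leaves the series of \<open>h\<close>, a combination
  of known series, times \<open>comp_fps\<close>.\<close>

lemma sum_last_term:
  assumes "1 \<le> n"
  shows "(\<Sum>L\<in>compositions n. last_term L) = 2 * comp_sym n - path_sym n + elem_sym 1 * comp_sym (n - 1)"
proof -
  define h :: "nat \<Rightarrow> rat mps" where "h k = (if 3 \<le> k then of_nat k * elem_sym k - 2 * elem_sym k else 0)" for k
  have last_term_snoc: "last_term (L @ [k]) = h k * (part_weight L *\<^sub>\<Lambda> elem_sym_comp L)" for L k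
  proof (cases "3 \<le> k")
    case True
    then have "(of_nat k - 2) / (of_nat k - 1) * part_weight (L @ [k]) = (of_nat k - of_nat 2) * part_weight L"
      by (simp add: part_weight_def field_simps)
    then have "last_term (L @ [k]) = ((of_nat k - of_nat 2) * part_weight L) *\<^sub>\<Lambda> (elem_sym k * elem_sym_comp L)"
      using True by (simp add: last_term_def elem_sym_comp_append mult.commute)
    also have "\<dots> = h k * (part_weight L *\<^sub>\<Lambda> elem_sym_comp L)"
      using True by (simp add: mps_scale_mult mps_scale_simps(2) mps_scale_of_nat h_def del: of_nat_numeral)
        simp
    finally show ?thesis .
  qed (simp add: last_term_def h_def)
  \<comment> \<open>The terms \<open>k * elem_sym k - 2 * elem_sym k\<close> are -2 at 0,
    \<open>- elem_sym 1\<close> at 1 and zero at 2; the last two summands cancel the first two of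
    these.\<close>
  have h_fps: "Abs_fps h = elem_deriv_fps - 2 * elem_fps + 2 + fps_const (elem_sym 1) * fps_X"
  proof (rule fps_ext)
    fix k :: nat
    consider "k = 0" | "k = 1" | "k = 2" | "3 \<le> k" by linarith
    then show "fps_nth (Abs_fps h) k =
        fps_nth (elem_deriv_fps - 2 * elem_fps + 2 + fps_const (elem_sym 1) * fps_X) k"
      by cases (simp_all add: h_def elem_deriv_fps_def elem_fps_def fps_numeral_nth numeral_fps_const fps_X_def)
  qed
  have "(\<Sum>L\<in>compositions n. last_term L) = (\<Sum>k=1..n. h k * comp_sym (n - k))"
    unfolding sum_compositions_snoc[OF assms] last_term_snoc by (simp add: comp_sym_def sum_distrib_left)
  also have "\<dots> = fps_nth (Abs_fps h * comp_fps) n"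
    by (simp add: fps_mult_nth comp_fps_def sum.atLeast_Suc_atMost[of 0] h_def)
  also have "Abs_fps h * comp_fps = 2 * comp_fps - path_fps - 1 + fps_const (elem_sym 1) * (fps_X * comp_fps)"
  proof -
    have "Abs_fps h * comp_fps = elem_deriv_fps * comp_fps - 2 * (elem_fps * comp_fps) + 2 * comp_fps
        + fps_const (elem_sym 1) * (fps_X * comp_fps)"
      unfolding h_fps by (simp add: algebra_simps)
    then show ?thesis unfolding elem_deriv_comp_fps path_fps_eq[symmetric] by (simp add: algebra_simps)
  qed
  also have "fps_nth \<dots> n = 2 * comp_sym n - path_sym n + elem_sym 1 * comp_sym (n - 1)"
    using assms by (simp add: numeral_fps_const comp_fps_def path_fps_def)
  finally show ?thesis .
qed


section \<open>Splitting compositions at a prescribed position\<close>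

text \<open>As the last part of \<open>K\<close> exceeds \<open>t\<close>, dropping it leaves a sum
  below \<open>a\<close>; hence \<open>a + t\<close> is the first partial sum that reaches
  \<open>a\<close>.\<close>

lemma Theta_plus_append:
  assumes "1 \<le> a" "K \<in> compositions (a + t)" "t < last K"
  shows "Theta_plus (K @ L) a = t"
proof -
  let ?S = "{sum_list (take k (K @ L)) | k. k \<le> length (K @ L) \<and> a \<le> sum_list (take k (K @ L))}"
  have K: "sum_list K = a + t" "K \<noteq> []" using assms by (auto simp: compositions_def)
  have "sum_list K = sum_list (butlast K) + last K"
    using K(2) by (metis append_butlast_last_id sum_list.Cons sum_list.Nil sum_list_append add_0_right)
  then have bl: "sum_list (butlast K) < a" using K assms by simp
  have "Min ?S = a + t"
  proof (rule Min_eqI)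
    show "finite ?S" by simp
    show "a + t \<in> ?S" using K by (auto intro!: exI[of _ "length K"])
    fix y assume "y \<in> ?S"
    then obtain k where k: "y = sum_list (take k (K @ L))" "a \<le> y" by auto
    show "a + t \<le> y"
    proof (cases "length K \<le> k")
      case True
      then show ?thesis using k K by simp
    next
      case False
      then have "butlast K = take k K @ drop k (butlast K)"
        by (metis append_take_drop_id butlast_conv_take take_take min_def not_less_eq_eq Suc_pred' length_greater_0_conv K(2) not_le)
      then have "sum_list (take k K) \<le> sum_list (butlast K)"
        by (metis le_add1 sum_list_append)
      then show ?thesis using bl k False by simp
    qed
  qed
  then show ?thesis by (simp add: Theta_plus_def sigma_plus_def)
qed

text \<open>The prefix \<open>K\<close> is the one that attains the minimum in
  \<open>sigma_plus\<close>.\<close>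

lemma Theta_plus_split:
  assumes "1 \<le> a" "a \<le> n" "I \<in> compositions n" "Theta_plus I a = t"
  obtains K L where "I = K @ L" "K \<in> compositions (a + t)" "t < last K" "L \<in> compositions (n - a - t)"
proof -
  let ?S = "{sum_list (take k I) | k. k \<le> length I \<and> a \<le> sum_list (take k I)}"
  have I: "sum_list I = n" "\<forall>i\<in>set I. 1 \<le> i" using assms by (auto simp: compositions_def)
  have fin: "finite ?S" by simp
  have "sum_list I \<in> ?S" using I assms by (auto intro!: exI[of _ "length I"])
  then have "Min ?S \<in> ?S" using fin by (intro Min_in) auto
  then obtain k where k: "Min ?S = sum_list (take k I)" "k \<le> length I" "a \<le> sum_list (take k I)" by auto
  let ?K = "take k I" and ?L = "drop k I"
  have K: "sum_list ?K = a + t"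
    using assms(4) k by (simp add: Theta_plus_def sigma_plus_def)
  then have ne: "?K \<noteq> []" using assms(1) by (metis add_is_0 not_one_le_zero sum_list.Nil)
  have split: "sum_list ?K = sum_list (butlast ?K) + last ?K"
    using ne by (metis append_butlast_last_id sum_list.Cons sum_list.Nil sum_list_append add_0_right)
  have "t < last ?K"
  proof (rule ccontr)
    \<comment> \<open>Otherwise the prefix without its last part would still reach \<open>a\<close>
      with a smaller sum, since parts are positive.\<close>
    assume "\<not> t < last ?K"
    then have "a \<le> sum_list (butlast ?K)" using split K by simp
    moreover have "butlast ?K = take (k - 1) I" using k by (simp add: butlast_take)
    ultimately have "sum_list (butlast ?K) \<in> ?S" using k by auto
    then have "sum_list ?K \<le> sum_list (butlast ?K)" using Min_le[OF fin] k by simp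
    moreover have "1 \<le> last ?K" using I(2) ne by (meson in_set_takeD last_in_set)
    ultimately show False using split by simp
  qed
  moreover have "sum_list ?L = n - a - t"
    using I K by (metis append_take_drop_id sum_list_append add_diff_cancel_left' diff_diff_left)
  ultimately show thesis
    using I K by (intro that[of ?K ?L]) (auto simp: compositions_def dest: in_set_takeD in_set_dropD)
qed

text \<open>One prefix extends the other by a list of positive parts with sum 0, which is empty.
  This makes the cut of a composition unique.\<close>

lemma append_eq_append_sum_list:
  fixes K K' L L' :: "nat list"
  assumes "K @ L = K' @ L'" "sum_list K = sum_list K'"
    and "\<forall>i\<in>set (K @ L). 1 \<le> i"
  shows "K = K'"
proof -
  from assms(1) obtain U where U: "K = K' @ U \<and> U @ L = L' \<or> K @ U = K' \<and> L = U @ L'"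
    by (auto simp: append_eq_append_conv2)
  then have "sum_list U = 0" "\<forall>i\<in>set U. 1 \<le> i" using assms(2,3) by auto
  then have "U = []" by (cases U) auto
  with U show ?thesis by auto
qed

lemma sum_Theta_plus_eq:
  assumes "1 \<le> a" "a + t \<le> n"
  shows "(\<Sum>I | I \<in> compositions n \<and> Theta_plus I a = t. \<phi> I) =
    (\<Sum>K | K \<in> compositions (a + t) \<and> t < last K. \<Sum>L\<in>compositions (n - a - t). \<phi> (K @ L))"
proof -
  let ?A = "{K \<in> compositions (a + t). t < last K}" and ?B = "compositions (n - a - t)"
  have inj: "inj_on (\<lambda>(K, L). K @ L) (?A \<times> ?B)"
  proof (rule inj_onI, clarify)
    fix K L K' L'
    assume KL: "K \<in> compositions (a + t)" "L \<in> ?B" "K' \<in> compositions (a + t)" and eq: "K @ L = K' @ L'"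
    have "sum_list K = sum_list K'" "\<forall>i\<in>set (K @ L). 1 \<le> i"
      using KL by (auto simp: compositions_def)
    from append_eq_append_sum_list[OF eq this] eq show "K = K' \<and> L = L'" by simp
  qed
  have "{I. I \<in> compositions n \<and> Theta_plus I a = t} = (\<lambda>(K, L). K @ L) ` (?A \<times> ?B)"
  proof (intro equalityI subsetI)
    fix I assume "I \<in> {I. I \<in> compositions n \<and> Theta_plus I a = t}"
    then have I: "I \<in> compositions n" "Theta_plus I a = t" by simp_all
    have "a \<le> n" using assms by simp
    from Theta_plus_split[OF assms(1) this I] obtain K L
      where "I = K @ L" "K \<in> compositions (a + t)" "t < last K" "L \<in> ?B" .
    then show "I \<in> (\<lambda>(K, L). K @ L) ` (?A \<times> ?B)" by auto
  next
    fix I assume "I \<in> (\<lambda>(K, L). K @ L) ` (?A \<times> ?B)"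
    then obtain K L where KL: "I = K @ L" "K \<in> compositions (a + t)" "t < last K" "L \<in> ?B" by auto
    then have "I \<in> compositions n" using assms by (auto simp: compositions_def)
    moreover have "Theta_plus I a = t" unfolding KL(1) by (rule Theta_plus_append) (fact assms KL)+
    ultimately show "I \<in> {I. I \<in> compositions n \<and> Theta_plus I a = t}" by simp
  qed
  then have "(\<Sum>I | I \<in> compositions n \<and> Theta_plus I a = t. \<phi> I) = (\<Sum>z\<in>?A \<times> ?B. \<phi> (fst z @ snd z))"
    using sum.reindex[OF inj, of \<phi>] by (simp only: comp_def case_prod_unfold)
  also have "\<dots> = (\<Sum>K\<in>?A. \<Sum>L\<in>?B. \<phi> (K @ L))"
    by (simp only: sum.cartesian_product case_prod_unfold)
  finally show ?thesis .
qed

text \<open>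
  For \<open>t \<le> 1\<close> the condition on the last part of the prefix is vacuous, as compositions
  with a last part \<open>1\<close> that is not the first part have weight \<open>0\<close>.
\<close>

lemma sum_Theta_plus_le_1:
  assumes "1 \<le> a" "t \<le> 1" "a + t \<le> n"
    and \<phi>: "\<And>K L. K \<noteq> [] \<Longrightarrow> L \<in> compositions (n - a - t) \<Longrightarrow>
      \<phi> (K @ L) = (comp_weight K *\<^sub>\<Lambda> elem_sym_comp K) * \<psi> L"
  shows "(\<Sum>I | I \<in> compositions n \<and> Theta_plus I a = t. \<phi> I) =
    path_sym (a + t) * (\<Sum>L\<in>compositions (n - a - t). \<psi> L)"
proof -
  have ne: "K \<noteq> []" if "K \<in> compositions (a + t)" for K using that assms by (auto simp: compositions_def)
  have zero: "comp_weight K *\<^sub>\<Lambda> elem_sym_comp K = 0" if K: "K \<in> compositions (a + t)" "\<not> t < last K" for K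
  proof -
    have "1 \<le> last K" using K(1) ne by (auto simp: compositions_def)
    then have last: "last K = 1" "t = 1" using K(2) assms(2) by auto
    \<comment> \<open>The final part 1 gives the factor 0 only if it is not the first part;
      \<open>[1]\<close> is ruled out because \<open>K\<close> has sum \<open>a + 1\<close>, at
      least 2.\<close>
    have "butlast K \<noteq> []"
    proof
      assume "butlast K = []"
      then have "K = [1]" using ne[OF K(1)] last by (metis append_butlast_last_id append_Nil)
      then show False using K(1) assms(1) last by (simp add: compositions_def)
    qed
    then have "comp_weight K = comp_weight (butlast K) * part_weight [last K]"
      using ne[OF K(1)] by (metis append_butlast_last_id comp_weight_append)
    then have "comp_weight K = 0" using last by (simp add: part_weight_def)
    then show ?thesis by (intro mps_eqI) (simp add: zero_mps.rep_eq)
  qed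
  have "(\<Sum>I | I \<in> compositions n \<and> Theta_plus I a = t. \<phi> I) =
      (\<Sum>K | K \<in> compositions (a + t) \<and> t < last K.
        (comp_weight K *\<^sub>\<Lambda> elem_sym_comp K) * (\<Sum>L\<in>compositions (n - a - t). \<psi> L))"
    unfolding sum_Theta_plus_eq[OF assms(1,3)] sum_distrib_left
    using ne by (intro sum.cong refl \<phi>) auto
  also have "\<dots> = (\<Sum>K\<in>compositions (a + t).
        (comp_weight K *\<^sub>\<Lambda> elem_sym_comp K) * (\<Sum>L\<in>compositions (n - a - t). \<psi> L))"
    by (intro sum.mono_neutral_left) (auto simp: finite_compositions zero)
  also have "\<dots> = path_sym (a + t) * (\<Sum>L\<in>compositions (n - a - t). \<psi> L)"
    using assms(1) by (simp add: path_sym_eq_sum_compositions sum_distrib_right)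
  finally show ?thesis .
qed

section \<open>The sums of the theorem in terms of paths and tails\<close>

lemma comp_weight_append_scale:
  "K \<noteq> [] \<Longrightarrow> comp_weight (K @ L) *\<^sub>\<Lambda> elem_sym_comp (K @ L) =
    (comp_weight K *\<^sub>\<Lambda> elem_sym_comp K) * (part_weight L *\<^sub>\<Lambda> elem_sym_comp L)"
  by (simp add: comp_weight_append elem_sym_comp_append mps_scale_mult)

text \<open>Complementary counting: from the sum over all compositions, those with value 0 or 1 are
  removed, each class being a product of a prefix sum and a tail sum.\<close>

lemma sum_Theta_plus_ge_2:
  assumes "1 \<le> a" "a + 1 \<le> n"
  shows "(\<Sum>I | I \<in> compositions n \<and> 2 \<le> Theta_plus I a. comp_weight I *\<^sub>\<Lambda> elem_sym_comp I) =
    path_sym n - path_sym a * comp_sym (n - a) - path_sym (a + 1) * comp_sym (n - a - 1)"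
proof -
  let ?f = "\<lambda>I. comp_weight I *\<^sub>\<Lambda> elem_sym_comp I"
  let ?S = "\<lambda>t. {I. I \<in> compositions n \<and> Theta_plus I a = t}"
  let ?T = "{I. I \<in> compositions n \<and> 2 \<le> Theta_plus I a}"
  have "compositions n = ?T \<union> (?S 0 \<union> ?S 1)" by auto
  then have "path_sym n = sum ?f (?T \<union> (?S 0 \<union> ?S 1))"
    using path_sym_eq_sum_compositions[of n] assms by simp
  also have "\<dots> = sum ?f ?T + sum ?f (?S 0 \<union> ?S 1)"
    by (rule sum.union_disjoint) (auto simp: finite_compositions)
  also have "sum ?f (?S 0 \<union> ?S 1) = sum ?f (?S 0) + sum ?f (?S 1)"
    by (rule sum.union_disjoint) (auto simp: finite_compositions)
  also have "sum ?f (?S 0) = path_sym a * comp_sym (n - a)"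
    using sum_Theta_plus_le_1[of a 0 n ?f "\<lambda>L. part_weight L *\<^sub>\<Lambda> elem_sym_comp L"] assms
    by (simp add: comp_weight_append_scale comp_sym_def)
  also have "sum ?f (?S 1) = path_sym (a + 1) * comp_sym (n - a - 1)"
    using sum_Theta_plus_le_1[of a 1 n ?f "\<lambda>L. part_weight L *\<^sub>\<Lambda> elem_sym_comp L"] assms
    by (simp add: comp_weight_append_scale comp_sym_def)
  finally show ?thesis by (simp add: algebra_simps)
qed

text \<open>With \<open>t\<close> at most 1, the tail has sum at least \<open>n - a - 1\<close>,
  which is positive. So the last part of the composition lies in the tail, and the prefix keeps its
  ordinary weight.\<close>

lemma sum_last_Theta_plus_le_1:
  assumes "1 \<le> a" "a + 2 \<le> n"
  shows "(\<Sum>I | I \<in> compositions n \<and> 3 \<le> last I \<and> Theta_plus I a \<le> 1.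
      ((of_nat (last I) - 2) / (of_nat (last I) - 1) * comp_weight I) *\<^sub>\<Lambda> elem_sym_comp I) =
    path_sym a * (\<Sum>L\<in>compositions (n - a). last_term L) +
    path_sym (a + 1) * (\<Sum>L\<in>compositions (n - a - 1). last_term L)"
proof -
  define f where "f I = (if 3 \<le> last I then
      ((of_nat (last I) - 2) / (of_nat (last I) - 1) * comp_weight I) *\<^sub>\<Lambda> elem_sym_comp I else 0)" for I
  let ?S = "\<lambda>t. {I. I \<in> compositions n \<and> Theta_plus I a = t}"
  have f: "f (K @ L) = (comp_weight K *\<^sub>\<Lambda> elem_sym_comp K) * last_term L"
    if "K \<noteq> []" "L \<in> compositions m" "1 \<le> m" for K L m
  proof -
    have "L \<noteq> []" using that by (auto simp: compositions_def)
    then show ?thesis using that(1)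
      by (simp add: f_def last_term_def comp_weight_append elem_sym_comp_append mult.left_commute
          flip: mps_scale_mult)
  qed
  have "(\<Sum>I | I \<in> compositions n \<and> 3 \<le> last I \<and> Theta_plus I a \<le> 1.
      ((of_nat (last I) - 2) / (of_nat (last I) - 1) * comp_weight I) *\<^sub>\<Lambda> elem_sym_comp I) =
      sum f (?S 0 \<union> ?S 1)"
    by (rule sum.mono_neutral_cong_left) (auto simp: finite_compositions f_def)
  also have "\<dots> = sum f (?S 0) + sum f (?S 1)"
    by (rule sum.union_disjoint) (auto simp: finite_compositions)
  also have "sum f (?S 0) = path_sym (a + 0) * (\<Sum>L\<in>compositions (n - a - 0). last_term L)"
    using assms by (intro sum_Theta_plus_le_1 f[where m = "n - a - 0"]) auto
  also have "sum f (?S 1) = path_sym (a + 1) * (\<Sum>L\<in>compositions (n - a - 1). last_term L)"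
    using assms by (intro sum_Theta_plus_le_1 f[where m = "n - a - 1"]) auto
  finally show ?thesis by simp
qed

theorem theorem3p11:
  fixes a n :: nat
  assumes "1 \<le> a" and "a + 2 \<le> n"
  shows "(chromatic_sym {1..n} (bull_edges a n) :: rat mps) =
      (\<Sum>I | I \<in> compositions n \<and> 3 \<le> last I \<and> Theta_plus I a \<le> 1.
         ((of_nat (last I) - 2) / (of_nat (last I) - 1) * comp_weight I) *\<^sub>\<Lambda> elem_sym_comp I)
    + (\<Sum>I | I \<in> compositions n \<and> 2 \<le> Theta_plus I a.
         (2 * comp_weight I) *\<^sub>\<Lambda> elem_sym_comp I)
    + (\<Sum>J | J \<in> compositions (n - 1) \<and> 2 \<le> Theta_plus J a.
         comp_weight J *\<^sub>\<Lambda> elem_sym_comp (J @ [1]))"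
    (is "_ = ?A + ?B + ?C")
proof -
  have A: "?A = path_sym a * (2 * comp_sym (n - a) - path_sym (n - a) + elem_sym 1 * comp_sym (n - a - 1)) +
      path_sym (a + 1) * (2 * comp_sym (n - a - 1) - path_sym (n - a - 1) + elem_sym 1 * comp_sym (n - a - 1 - 1))"
    using assms by (simp only: sum_last_Theta_plus_le_1[OF assms]) (simp add: sum_last_term)
  have two: "(2 * c) *\<^sub>\<Lambda> f = 2 * (c *\<^sub>\<Lambda> f)" for c :: rat and f
    using mps_scale_of_nat[of 2 "c *\<^sub>\<Lambda> f"] by (simp add: mps_scale_simps)
  have B: "?B = 2 * (path_sym n - path_sym a * comp_sym (n - a) - path_sym (a + 1) * comp_sym (n - a - 1))"
    using assms by (simp only: two sum_distrib_left[symmetric]) (simp add: sum_Theta_plus_ge_2)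
  have one: "c *\<^sub>\<Lambda> elem_sym_comp (J @ [1]) = (c *\<^sub>\<Lambda> elem_sym_comp J) * elem_sym 1" for c :: rat and J
    using mps_scale_mult[of c 1 "elem_sym_comp J" "elem_sym 1"]
    by (simp add: elem_sym_comp_append mps_scale_simps(1))
  \<comment> \<open>Here the complementary count is applied to \<open>n - 1\<close>, where
    \<open>a + 1\<close> is still at most the total.\<close>
  have C: "?C = (path_sym (n - 1) - path_sym a * comp_sym (n - 1 - a) - path_sym (a + 1) * comp_sym (n - 1 - a - 1)) * elem_sym 1"
    using assms by (simp only: one sum_distrib_right[symmetric]) (simp add: sum_Theta_plus_ge_2)
  have "n - 1 - a = n - a - 1" by simp
  \<comment> \<open>The products of path functions with \<open>comp_sym\<close> cancel: those with
    factor 2 between the first two sums, those with \<open>elem_sym 1\<close> between the first and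
    the third. What remains is the expression for the bull words.\<close>
  then show ?thesis
    unfolding A B C chromatic_sym_bull[OF assms] mps_gf_bull_words[OF assms]
    by (simp add: algebra_simps)
qed

end
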